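(* For any positive integers $\alpha,m,n,r$, we have $$\sum_{k=0}^{n-1}[k(k+2)]^r\,[2(k+1)]\,q^{(n-2-k)(2\alpha m+1)}\left(w_k^{(\alpha)}(x;q)\,w_{k+1}^{(\alpha)}(x;q)\right)^m\equiv 0\pmod{[n]},$$ where the congruence is in the ring $\mathbb{Z}[q,q^{-1}][x]$.
   Context: Here $q$ and $x$ are indeterminates. For an integer $N$, $[N]=\frac{1-q^N}{1-q}$ is the $q$-integer, an element of $\mathbb{Z}[q,q^{-1}]$; in particular $[k(k+2)]$ is the $q$-integer of the number $k(k+2)$. For nonnegative integers $N$ and integers $k$, $\left[\begin{matrix} N \\ k \end{matrix}\right]=\frac{\prod_{1\le j\le k}[N-j+1]}{\prod_{1\le j\le k}[j]}$ is the $q$-binomial coefficient, equal to $1$ if $k=0$ and to $0$ if $k<0$ or $k>N$. For a nonnegative integer $k$ and a positive integer $\alpha$, $$w_k^{(\alpha)}(x;q)=\sum_{j=1}^{k}q^{\alpha\left(\binom{j+1}{2}-(k+1)(j-1)\right)}\left(\left[\begin{matrix} k-1 \\ j-1 \end{matrix}\right]\left[\begin{matrix} k+j \\ j \end{matrix}\right]-\left[\begin{matrix} k \\ j \end{matrix}\right]\left[\begin{matrix} k+j \\ j-1 \end{matrix}\right]\right)^{\alpha}x^{j-1}\in\mathbb{Z}[q,q^{-1}][x],$$ with $w_0^{(\alpha)}(x;q)=0$ (empty sum). A congruence $A\equiv 0\pmod{P(q)}$ means that $P(q)$ divides $A$ in $\mathbb{Z}[q,q^{-1}][x]$. *)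

theory Defs
  imports "HOL-Library.Poly_Mapping" "HOL-Computational_Algebra.Polynomial"
begin

text \<open>
  The ring of Laurent polynomials in \<open>q\<close> over the integers is the group ring of the additive
  group of integers: finitely supported maps from exponents to coefficients, with convolution
  as product. Polynomials in \<open>x\<close> over it are then elements of \<open>laurent poly\<close>, and \<open>dvd\<close> on
  that type is divisibility in this ring (in particular not in a ring of Laurent series or
  rational functions in \<open>q\<close>, where \<open>q\<close>-integers would be units).
\<close>

type_synonym laurent = "int \<Rightarrow>\<^sub>0 int"

definition qpow :: "int \<Rightarrow> laurent" where
  "qpow e = Poly_Mapping.single e 1"

text \<open>
  The quotient of \<open>a\<close> by \<open>b\<close>. It is used only where \<open>b\<close> is nonzero and divides \<open>a\<close>, so that
  the quotient in the field of fractions lies in the ring; see \<open>qint_mult\<close> and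
  \<open>qbinom_mult\<close> below.
\<close>

definition quot :: "laurent \<Rightarrow> laurent \<Rightarrow> laurent" where
  "quot a b = (THE c. c * b = a)"

definition qint :: "int \<Rightarrow> laurent" where
  "qint N = quot (1 - qpow N) (1 - qpow 1)"

definition qbinom :: "nat \<Rightarrow> int \<Rightarrow> laurent" where
  "qbinom N k =
     (if k < 0 then 0
      else quot (\<Prod>j\<in>{1..k}. qint (int N - j + 1)) (\<Prod>j\<in>{1..k}. qint j))"

definition w :: "nat \<Rightarrow> nat \<Rightarrow> laurent poly" where
  "w \<alpha> k = (\<Sum>j=1..k.
     monom
       (qpow (int \<alpha> * (int ((j + 1) choose 2) - (int k + 1) * (int j - 1)))
        * (qbinom (k - 1) (int j - 1) * qbinom (k + j) (int j)
           - qbinom k (int j) * qbinom (k + j) (int j - 1)) ^ \<alpha>)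
       (j - 1))"


subsection \<open>The quotients are exact\<close>

lemma quot_eq:
  assumes "b \<noteq> 0" "c * b = a"
  shows "quot a b = c"
  unfolding quot_def using assms by (auto intro!: the_equality)

lemma qpow_0 [simp]: "qpow 0 = 1"
  by (simp add: qpow_def)

lemma qpow_add: "qpow (a + b) = qpow a * qpow b"
  by (simp add: qpow_def mult_single)

lemma qpow_eq_iff: "qpow a = qpow b \<longleftrightarrow> a = b"
  unfolding qpow_def by (metis lookup_single_eq lookup_single_not_eq zero_neq_one)

lemma qpow_neq_1: "a \<noteq> 0 \<Longrightarrow> 1 - qpow a \<noteq> 0"
  using qpow_eq_iff[of 0 a] by auto

lemma qint_nat_aux: "(\<Sum>i<n. qpow (int i)) * (1 - qpow 1) = 1 - qpow (int n)"
proof (induction n)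
  case (Suc n)
  have "qpow (int (Suc n)) = qpow (int n) * qpow 1"
    by (simp add: add.commute flip: qpow_add)
  then show ?case
    by (simp only: sum.lessThan_Suc distrib_right Suc.IH) (simp add: right_diff_distrib)
qed simp

lemma qint_mult: "qint N * (1 - qpow 1) = 1 - qpow N"
proof -
  have "\<exists>c. c * (1 - qpow 1) = 1 - qpow N"
  proof (cases "N \<ge> 0")
    case True
    then show ?thesis using qint_nat_aux[of "nat N"] by auto
  next
    case False
    define n where "n = nat (- N)"
    have "(- qpow N * (\<Sum>i<n. qpow (int i))) * (1 - qpow 1) = - qpow N * (1 - qpow (int n))"
      using qint_nat_aux[of n] by (simp add: mult.assoc)
    also have "\<dots> = 1 - qpow N"
      using False by (simp add: n_def algebra_simps flip: qpow_add)
    finally show ?thesis by blast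
  qed
  then obtain c where c: "c * (1 - qpow 1) = 1 - qpow N" ..
  then have "qint N = c"
    unfolding qint_def by (intro quot_eq qpow_neq_1) auto
  with c show ?thesis by simp
qed

lemma qint_eqI: "c * (1 - qpow 1) = 1 - qpow N \<Longrightarrow> qint N = c"
  unfolding qint_def by (intro quot_eq qpow_neq_1) auto

lemma qint_of_nat: "qint (int n) = (\<Sum>i<n. qpow (int i))"
  by (intro qint_eqI qint_nat_aux)

lemma qint_0 [simp]: "qint 0 = 0"
  by (rule qint_eqI) simp

lemma qint_add: "qint (a + b) = qint a + qpow a * qint b"
  by (rule qint_eqI)
    (simp only: distrib_right mult.assoc qint_mult, simp add: right_diff_distrib qpow_add)

lemma qint_eq_0_iff: "qint N = 0 \<longleftrightarrow> N = 0"
  using qint_mult[of N] qpow_neq_1[of N] by (metis mult_zero_left qint_0)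

lemma prod_qint_neq_0: "(\<Prod>j\<in>{1..k::int}. qint j) \<noteq> 0"
  by (auto simp: qint_eq_0_iff)

lemma prod_int_Suc:
  fixes f :: "int \<Rightarrow> laurent"
  shows "prod f {1..int (Suc k)} = prod f {1..int k} * f (int k + 1)"
proof -
  have "{1..int (Suc k)} = insert (int k + 1) {1..int k}" by auto
  then show ?thesis by (simp add: mult.commute)
qed

lemma prod_qint_shift:
  "(\<Prod>j\<in>{1..int (Suc k)}. qint (int (Suc N) - j + 1))
     = qint (int N + 1) * (\<Prod>j\<in>{1..int k}. qint (int N - j + 1))"
  by (induction k)
    (simp, simp only: prod_int_Suc, simp add: algebra_simps)

lemma qbinom_exists:
  "\<exists>c. c * (\<Prod>j\<in>{1..int k}. qint j) = (\<Prod>j\<in>{1..int k}. qint (int N - j + 1))"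
proof (induction N arbitrary: k)
  case 0
  show ?case
  proof (cases k)
    case (Suc l)
    then have "(\<Prod>j\<in>{1..int k}. qint (int 0 - j + 1)) = 0"
      by (intro prod_zero) (auto intro!: bexI[of _ 1])
    then show ?thesis by (intro exI[of _ 0]) simp
  qed auto
next
  case (Suc N)
  show ?case
  proof (cases k)
    case (Suc l)
    let ?D = "\<lambda>k. \<Prod>j\<in>{1..int k}. qint j"
    let ?F = "\<lambda>k. \<Prod>j\<in>{1..int k}. qint (int N - j + 1)"
    obtain a b where a: "a * ?D l = ?F l" and b: "b * ?D (Suc l) = ?F (Suc l)"
      using Suc.IH by metis
    have D: "?D (Suc l) = ?D l * qint (int l + 1)" by (rule prod_int_Suc)
    have F: "?F (Suc l) = ?F l * qint (int N - int l)"
      by (subst prod_int_Suc) simp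
    have "(a + qpow (int l + 1) * b) * ?D (Suc l)
        = a * ?D l * qint (int l + 1) + qpow (int l + 1) * (b * ?D (Suc l))"
      unfolding D by (simp only: algebra_simps)
    also have "\<dots> = ?F l * (qint (int l + 1) + qpow (int l + 1) * qint (int N - int l))"
      unfolding a b F by (simp only: algebra_simps)
    also have "\<dots> = ?F l * qint (int N + 1)"
      by (subst qint_add [symmetric]) (simp add: algebra_simps)
    finally show ?thesis
      unfolding Suc prod_qint_shift by (metis mult.commute)
  qed auto
qed

lemma qbinom_mult:
  assumes "k \<ge> 0"
  shows "qbinom N k * (\<Prod>j\<in>{1..k}. qint j) = (\<Prod>j\<in>{1..k}. qint (int N - j + 1))"
proof -
  obtain c where c: "c * (\<Prod>j\<in>{1..k}. qint j) = (\<Prod>j\<in>{1..k}. qint (int N - j + 1))"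
    using qbinom_exists[of "nat k" N] assms by auto
  moreover from c have "qbinom N k = c"
    using assms unfolding qbinom_def by (simp add: quot_eq[OF prod_qint_neq_0])
  ultimately show ?thesis by simp
qed

lemma qbinom_neg [simp]: "k < 0 \<Longrightarrow> qbinom N k = 0"
  by (simp add: qbinom_def)

lemma qbinom_0_right [simp]: "qbinom N 0 = 1"
  using qbinom_mult[of 0 N] by simp

lemma qbinom_gt:
  assumes "k > int N"
  shows "qbinom N k = 0"
proof -
  have "(\<Prod>j\<in>{1..k}. qint (int N - j + 1)) = 0"
    using assms by (intro prod_zero) (auto intro!: bexI[of _ "int N + 1"])
  then show ?thesis
    using qbinom_mult[of k N] prod_qint_neq_0[of k] assms
    by (metis le_less_trans mult_eq_0_iff of_nat_0_le_iff order_less_imp_le)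
qed

end

theory Submission
  imports Complex_Main Defs
begin

text \<open>
  The sum is divisible by \<open>[n]\<close> iff it vanishes when \<open>q\<close> is replaced by any \<open>n\<close>-th root of
  unity \<open>z \<noteq> 1\<close>. Let \<open>d\<close> be the order of \<open>z\<close> and write \<open>k = a d + b\<close> with \<open>0 \<le> b < d\<close>.
  The factors \<open>[k (k + 2)]\<^sup>r [2 (k + 1)]\<close> kill the summands with \<open>b \<in> {0, d - 2, d - 1}\<close>; the
  others cancel in pairs under the reflection \<open>b \<mapsto> d - 2 - b\<close>.

  For this one needs that at \<open>z\<close> the coefficient of \<open>x\<^sup>j\<^sup>-\<^sup>1\<close> in \<open>w\<^sub>k\<close> is, up to a power of \<open>z\<close>, invariant
  under \<open>b \<mapsto> d - 1 - b\<close> when \<open>1 \<le> b \<le> d - 2\<close>. The \<open>q\<close>-Lucas theorem reduces this to \<open>a = 0\<close> and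
  \<open>0 < j < d\<close>, where the closed form \<open>q\<^sup>k \<Prod>\<^sub>2\<^sub>\<le>\<^sub>i\<^sub>\<le>\<^sub>j [k + i] [k + 1 - i] / ([j]! [j - 1]!)\<close> has a nonzero denominator
  at \<open>z\<close> and the symmetry \<open>k \<mapsto> -1 - k\<close>.
\<close>

section \<open>The \<open>q\<close>-Pascal rule and a closed form for the coefficients of
  \<open>w\<close>\<close>

text \<open>Multiplied by the nonzero \<open>[k+1]!\<close>, both sides share the factor
  \<open>[N] ... [N-k+1]\<close>, and what remains is
  \<open>[k+1] + q^(k+1) [N-k] = [N+1]\<close>.\<close>

lemma qbinom_Suc_Suc:
  "qbinom (Suc N) (int (Suc k))
     = qbinom N (int k) + qpow (int (Suc k)) * qbinom N (int (Suc k))"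
proof -
  let ?D = "\<lambda>k. \<Prod>j\<in>{1..int k}. qint j"
  let ?F = "\<lambda>k. \<Prod>j\<in>{1..int k}. qint (int N - j + 1)"
  have D: "?D (Suc k) = ?D k * qint (int k + 1)" by (rule prod_int_Suc)
  have F: "?F (Suc k) = ?F k * qint (int N - int k)"
    by (subst prod_int_Suc) simp
  have a: "qbinom N (int l) * ?D l = ?F l" for l
    by (rule qbinom_mult) simp
  have "(qbinom N (int k) + qpow (int k + 1) * qbinom N (int (Suc k))) * ?D (Suc k)
      = qbinom N (int k) * ?D k * qint (int k + 1)
        + qpow (int k + 1) * (qbinom N (int (Suc k)) * ?D (Suc k))"
    unfolding D by (simp only: algebra_simps)
  also have "\<dots> = ?F k * (qint (int k + 1) + qpow (int k + 1) * qint (int N - int k))"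
    unfolding a F by (simp only: algebra_simps)
  also have "\<dots> = ?F k * qint (int N + 1)"
    by (subst qint_add [symmetric]) (simp add: algebra_simps)
  also have "\<dots> = qbinom (Suc N) (int (Suc k)) * ?D (Suc k)"
    unfolding qbinom_mult[OF of_nat_0_le_iff] prod_qint_shift by (rule mult.commute)
  finally have "qbinom N (int k) + qpow (int k + 1) * qbinom N (int (Suc k))
      = qbinom (Suc N) (int (Suc k))"
    by (rule mult_right_cancel[OF prod_qint_neq_0, THEN iffD1])
  moreover have "int k + 1 = int (Suc k)" by simp
  ultimately show ?thesis by (simp only:)
qed

text \<open>\<open>q\<close>-analogues of \<open>(1 / j) (k - 1 choose j - 1) (k + j choose j - 1)\<close>\<close>

definition narayana :: "nat \<Rightarrow> nat \<Rightarrow> laurent" where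
  "narayana k j = qbinom (k - 1) (int j - 1) * qbinom (k + j) (int j)
     - qbinom k (int j) * qbinom (k + j) (int j - 1)"

lemma prod_int_ivl_reindex:
  fixes f :: "int \<Rightarrow> 'a :: comm_monoid_mult"
  shows "(\<Prod>j\<in>{1..int k}. f j) = (\<Prod>i=1..k. f (int i))"
  by (rule prod.reindex_bij_witness[of _ int nat]) auto

lemma qbinom_mult_nat:
  "qbinom N (int k) * (\<Prod>i=1..k. qint (int i)) = (\<Prod>i=1..k. qint (int N - int i + 1))"
  using qbinom_mult[of "int k" N] by (simp add: prod_int_ivl_reindex)

lemma qbinom_nat_gt: "N < k \<Longrightarrow> qbinom N (int k) = 0"
  by (simp add: qbinom_gt)

lemma qbinom_self: "qbinom N (int N) = 1"
proof -
  have "(\<Prod>i=1..N. qint (int N - int i + 1)) = (\<Prod>i=1..N. qint (int i))"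
    by (rule prod.reindex_bij_witness[of _ "\<lambda>i. Suc N - i" "\<lambda>i. Suc N - i"])
      (auto simp: of_nat_diff algebra_simps)
  then have "qbinom N (int N) * (\<Prod>i=1..N. qint (int i)) = 1 * (\<Prod>i=1..N. qint (int i))"
    by (simp only: qbinom_mult_nat mult_1)
  moreover have "(\<Prod>i=1..N. qint (int i)) \<noteq> 0"
    by (auto simp: qint_eq_0_iff)
  ultimately show ?thesis
    using mult_right_cancel by blast
qed

text \<open>Once the denominators are cleared, both products in \<open>narayana\<close> contain
  \<open>?A * ?B\<close>; the remaining cofactor is \<open>[k+1] - [k] = q^k\<close>.\<close>

lemma narayana_closed_form:
  assumes "k > 0" and "j > 0"
  shows "narayana k j * ((\<Prod>i=1..j. qint (int i)) * (\<Prod>i=1..j-1. qint (int i)))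
     = qpow (int k) * (\<Prod>i=2..j. qint (int k + int i) * qint (int k + 1 - int i))"
proof -
  obtain l where j: "j = Suc l" using assms by (cases j) auto
  let ?P = "\<lambda>j. \<Prod>i=1..j. qint (int i)"
  let ?A = "\<Prod>i=2..j. qint (int k + 1 - int i)"
  let ?B = "\<Prod>i=2..j. qint (int k + int i)"
  have first: "(\<Prod>i=1..j. g i) = g 1 * (\<Prod>i=2..j. g i)" for g :: "nat \<Rightarrow> laurent"
    using assms prod.atLeast_Suc_atMost[of 1 j g] by (simp add: numeral_2_eq_2)
  have 1: "qbinom (k - 1) (int j - 1) * ?P l = ?A"
  proof -
    have "qbinom (k - 1) (int l) * ?P l = (\<Prod>i=1..l. qint (int (k - 1) - int i + 1))"
      by (rule qbinom_mult_nat)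
    also have "\<dots> = ?A"
      unfolding j by (rule prod.reindex_bij_witness[of _ "\<lambda>i. i - 1" Suc])
        (use assms in \<open>auto simp: of_nat_diff algebra_simps\<close>)
    finally show ?thesis by (simp add: j)
  qed
  have 2: "qbinom k (int j) * ?P j = qint (int k) * ?A"
    unfolding qbinom_mult_nat by (subst first) (simp add: algebra_simps)
  have 3: "qbinom (k + j) (int j - 1) * ?P l = ?B"
  proof -
    have "qbinom (k + j) (int l) * ?P l = (\<Prod>i=1..l. qint (int (k + j) - int i + 1))"
      by (rule qbinom_mult_nat)
    also have "\<dots> = ?B"
      unfolding j by (rule prod.reindex_bij_witness[of _ "\<lambda>i. Suc (Suc l) - i" "\<lambda>i. Suc (Suc l) - i"])
        (auto simp: of_nat_diff algebra_simps)
    finally show ?thesis by (simp add: j)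
  qed
  have 4: "qbinom (k + j) (int j) * ?P j = qint (int k + 1) * ?B"
  proof -
    have "qbinom (k + j) (int j) * ?P j = (\<Prod>i=1..j. qint (int (k + j) - int i + 1))"
      by (rule qbinom_mult_nat)
    also have "\<dots> = (\<Prod>i=1..j. qint (int k + int i))"
      by (rule prod.reindex_bij_witness[of _ "\<lambda>i. Suc j - i" "\<lambda>i. Suc j - i"])
        (auto simp: of_nat_diff algebra_simps)
    also have "\<dots> = qint (int k + 1) * ?B"
      unfolding first by simp
    finally show ?thesis .
  qed
  have "narayana k j * (?P j * ?P l)
      = (qbinom (k - 1) (int j - 1) * ?P l) * (qbinom (k + j) (int j) * ?P j)
        - (qbinom k (int j) * ?P j) * (qbinom (k + j) (int j - 1) * ?P l)"
    unfolding narayana_def by (simp add: algebra_simps)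
  also have "\<dots> = (qint (int k + 1) - qint (int k)) * (?B * ?A)"
    unfolding 1 2 3 4 by (simp add: algebra_simps)
  also have "qint (int k + 1) - qint (int k) = qpow (int k)"
    using qint_add[of "int k" 1] qint_of_nat[of 1] by simp
  finally show ?thesis by (simp only: j prod.distrib diff_Suc_1)
qed

section \<open>Evaluation of Laurent polynomials at complex numbers\<close>

text \<open>The substitution \<open>q = z\<close>. It is multiplicative only for nonzero
  \<open>z\<close>, because \<open>0 powi e\<close> is \<open>0\<close> for negative
  \<open>e\<close>.\<close>

definition ev :: "complex \<Rightarrow> laurent \<Rightarrow> complex" where
  "ev z p = (\<Sum>e\<in>Poly_Mapping.keys p. of_int (Poly_Mapping.lookup p e) * z powi e)"

lemma ev_superset:
  assumes "finite A" and "Poly_Mapping.keys p \<subseteq> A"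
  shows "ev z p = (\<Sum>e\<in>A. of_int (Poly_Mapping.lookup p e) * z powi e)"
  unfolding ev_def using assms
  by (intro sum.mono_neutral_left) (auto simp: in_keys_iff)

lemma ev_0 [simp]: "ev z 0 = 0"
  by (simp add: ev_def)

lemma ev_add [simp]: "ev z (p + q) = ev z p + ev z q"
proof -
  let ?A = "Poly_Mapping.keys p \<union> Poly_Mapping.keys q"
  have "finite ?A" "Poly_Mapping.keys (p + q) \<subseteq> ?A"
    using Poly_Mapping.keys_add[of p q] by auto
  then show ?thesis
    by (simp add: ev_superset[of ?A] lookup_add algebra_simps sum.distrib)
qed

lemma ev_diff [simp]: "ev z (p - q) = ev z p - ev z q"
  using ev_add[of z "p - q" q] by simp

lemma ev_minus [simp]: "ev z (- p) = - ev z p"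
  using ev_diff[of z 0 p] by simp

lemma ev_qpow [simp]: "ev z (qpow e) = z powi e"
  by (simp add: ev_def qpow_def)

lemma ev_1 [simp]: "ev z 1 = 1"
  using ev_qpow[of z 0] by (simp del: ev_qpow)

text \<open>Additively the ring is the free abelian group on the exponents, so closure under
  differences reaches every element from the monomials.\<close>

lemma laurent_induct [case_names zero qpow diff]:
  fixes p :: laurent
  assumes "P 0" and "\<And>e. P (qpow e)" and "\<And>p q. P p \<Longrightarrow> P q \<Longrightarrow> P (p - q)"
  shows "P p"
  by (rule frag_induction[of p UNIV]) (use assms in \<open>auto simp: qpow_def\<close>)

lemma ev_mult [simp]:
  assumes "z \<noteq> 0"
  shows "ev z (p * q) = ev z p * ev z q"
proof (induction p rule: laurent_induct)
  case (qpow e)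
  show ?case
    by (induction q rule: laurent_induct)
      (use assms in \<open>simp_all add: power_int_add right_diff_distrib flip: qpow_add\<close>)
qed (simp_all add: left_diff_distrib)

lemma ev_power [simp]: "z \<noteq> 0 \<Longrightarrow> ev z (p ^ i) = ev z p ^ i"
  by (induction i) auto

lemma ev_sum [simp]: "ev z (sum f A) = (\<Sum>i\<in>A. ev z (f i))"
  by (induction A rule: infinite_finite_induct) auto

lemma ev_prod [simp]: "z \<noteq> 0 \<Longrightarrow> ev z (prod f A) = (\<Prod>i\<in>A. ev z (f i))"
  by (induction A rule: infinite_finite_induct) auto

lemma ev_of_int [simp]: "ev z (of_int i) = of_int i"
proof -
  have "ev z (of_nat j) = of_nat j" for j by (induction j) auto
  then show ?thesis by (cases i rule: int_cases2) auto
qed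

lemma ev_qint:
  assumes "z \<noteq> 0" and "z \<noteq> 1"
  shows "ev z (qint N) = (1 - z powi N) / (1 - z)"
  using arg_cong[OF qint_mult[of N], of "ev z"] assms by (simp add: field_simps)

lemma ev_eq_0_dvd:
  assumes "z \<noteq> 0" "ev z p = 0" "p dvd q"
  shows "ev z q = 0"
  using assms by (auto simp: dvd_def)

section \<open>Divisibility by \<open>[n]\<close> tested at roots of unity\<close>

lemma qint_dvd_one_minus_qpow: "qint N dvd 1 - qpow N"
  using qint_mult[of N] by (metis dvd_triv_left)

lemma one_minus_qpow_dvd: "1 - qpow N dvd 1 - qpow (N * t)"
proof (induction t rule: int_induct[where k = 0])
  case (step1 i)
  have "1 - qpow (N * (i + 1)) = (1 - qpow (N * i)) + qpow (N * i) * (1 - qpow N)"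
    by (simp add: algebra_simps flip: qpow_add)
  with step1(2) show ?case by (simp only: dvd_add dvd_triv_right)
next
  case (step2 i)
  have "1 - qpow (N * (i - 1)) = (1 - qpow (N * i)) - qpow (N * (i - 1)) * (1 - qpow N)"
    by (simp add: algebra_simps flip: qpow_add)
  with step2(2) show ?case by (simp only: dvd_diff dvd_triv_right)
qed simp

text \<open>Modulo \<open>[n]\<close> one has \<open>q^n = 1\<close>, so all exponents, negative
  ones included, reduce to the range below \<open>n\<close>.\<close>

lemma laurent_mod_qint:
  assumes "n > 0"
  shows "\<exists>f. qint (int n) dvd p - (\<Sum>i<n. of_int (f i) * qpow (int i))"
proof (induction p rule: laurent_induct)
  case zero
  show ?case by (intro exI[of _ "\<lambda>_. 0"]) simp
next
  case (qpow e)
  define s where "s = nat (e mod int n)"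
  have s: "s < n" "e = int s + int n * (e div int n)"
    using assms by (auto simp: s_def nat_less_iff)
  have "(\<Sum>i<n. of_int (if i = s then 1 else 0) * qpow (int i))
      = (\<Sum>i<n. if i = s then qpow (int i) else 0)"
    by (intro sum.cong) auto
  also have "\<dots> = qpow (int s)"
    using s by simp
  finally have "qpow e - (\<Sum>i<n. of_int (if i = s then 1 else 0) * qpow (int i))
      = - qpow (int s) * (1 - qpow (int n * (e div int n)))"
    by (subst s(2)) (simp add: qpow_add algebra_simps)
  moreover have "qint (int n) dvd 1 - qpow (int n * (e div int n))"
    using qint_dvd_one_minus_qpow one_minus_qpow_dvd dvd_trans by blast
  ultimately show ?case
    by (intro exI[of _ "\<lambda>i. if i = s then 1 else 0"]) (simp only: dvd_mult)
next
  case (diff p q)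
  then obtain f g where
    "qint (int n) dvd p - (\<Sum>i<n. of_int (f i) * qpow (int i))"
    "qint (int n) dvd q - (\<Sum>i<n. of_int (g i) * qpow (int i))" by blast
  then have "qint (int n) dvd (p - (\<Sum>i<n. of_int (f i) * qpow (int i)))
      - (q - (\<Sum>i<n. of_int (g i) * qpow (int i)))" by (rule dvd_diff)
  then show ?case
    by (intro exI[of _ "\<lambda>i. f i - g i"]) (simp add: algebra_simps sum_subtractf)
qed

text \<open>The remainder of \<open>p\<close> vanishes at the \<open>n - 1\<close> nontrivial roots
  of unity, which forces all its \<open>n\<close> integer coefficients to be equal. It is then an
  integer multiple of \<open>[n]\<close>, so the divisibility holds over the integers and not merely
  over the complex numbers.\<close>

lemma qint_dvd_if_roots:
  assumes "n > 0" and roots: "\<And>z. z ^ n = 1 \<Longrightarrow> z \<noteq> 1 \<Longrightarrow> ev z p = 0"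
  shows "qint (int n) dvd p"
proof -
  obtain f where f: "qint (int n) dvd p - (\<Sum>i<n. of_int (f i) * qpow (int i))"
    using laurent_mod_qint[OF assms(1)] by blast
  \<comment> \<open>Subtracting \<open>f (n - 1)\<close> times \<open>[n]\<close> keeps the values
    at the roots and removes the coefficient at \<open>n - 1\<close>, so a nonzero \<open>F\<close>
    would have more roots than its degree.\<close>
  define F :: "complex poly" where "F = (\<Sum>i<n. monom (of_int (f i - f (n - 1))) i)"
  have coeff_F: "coeff F i = (if i < n then of_int (f i - f (n - 1)) else 0)" for i
    by (auto simp: F_def coeff_sum if_distrib cong: if_cong)
  have root: "poly F z = 0" if z: "z ^ n = 1" "z \<noteq> 1" for z
  proof -
    have z0: "z \<noteq> 0" using z assms(1) by (auto simp: power_0_left)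
    have "ev z (qint (int n)) = 0"
      using z z0 by (simp add: ev_qint)
    from ev_eq_0_dvd[OF z0 this f] have "(\<Sum>i<n. of_int (f i) * z ^ i) = 0"
      using z0 roots[OF z] by simp
    moreover have "(\<Sum>i<n. z ^ i) = 0"
      using z by (simp add: sum_gp_strict)
    ultimately show ?thesis
      by (simp add: F_def poly_sum poly_monom left_diff_distrib sum_subtractf
          flip: sum_distrib_left)
  qed
  have "F = 0"
  proof (rule ccontr)
    assume "F \<noteq> 0"
    then have "coeff F (degree F) \<noteq> 0" by simp
    then have "degree F < n - 1"
      by (auto simp: coeff_F split: if_splits)
         (metis Suc_pred assms(1) diff_self less_antisym of_int_0)
    have "card {z::complex. z ^ n = 1} = n"
      using assms(1) by (intro card_roots_unity_eq)
    moreover have "finite {z::complex. z ^ n = 1}"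
      using assms(1) by (metis calculation card.infinite less_irrefl)
    ultimately have "n - 1 = card ({z::complex. z ^ n = 1} - {1})"
      by simp
    also have "\<dots> \<le> card {z. poly F z = 0}"
      using root \<open>F \<noteq> 0\<close> by (intro card_mono poly_roots_finite) auto
    also have "\<dots> \<le> degree F"
      using \<open>F \<noteq> 0\<close> by (rule card_poly_roots_bound)
    finally show False using \<open>degree F < n - 1\<close> by simp
  qed
  then have const: "f i = f (n - 1)" if "i < n" for i
    using coeff_F[of i] that by simp
  have "(\<Sum>i<n. of_int (f i) * qpow (int i)) = of_int (f (n - 1)) * qint (int n)"
    unfolding qint_of_nat sum_distrib_left
  proof (rule sum.cong)
    fix i assume "i \<in> {..<n}"
    then have "f i = f (n - 1)" using const[of i] by blast
    then show "of_int (f i) * qpow (int i) = of_int (f (n - 1)) * qpow (int i)"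
      by (rule arg_cong)
  qed simp
  from dvd_add[OF f[unfolded this] dvd_triv_right[of _ "of_int (f (n - 1))"]] show ?thesis
    by (simp only: diff_add_cancel)
qed

section \<open>\<open>q\<close>-binomials at a root of unity of exact order \<open>d\<close>\<close>

locale primitive_root =
  fixes z :: complex and d :: nat
  assumes d_ge_2: "d \<ge> 2"
    and power_d: "z ^ d = 1"
    and power_neq_1: "\<And>i. 0 < i \<Longrightarrow> i < d \<Longrightarrow> z ^ i \<noteq> 1"
begin

lemma z_neq_1: "z \<noteq> 1"
  using power_neq_1[of 1] d_ge_2 by simp

lemma z_neq_0 [simp]: "z \<noteq> 0"
  using power_d d_ge_2 by (auto simp: power_0_left)

text \<open>Exponents matter only modulo \<open>d\<close>. Later comparisons supply \<open>t\<close>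
  explicitly, which leaves an identity between integers.\<close>

lemma powi_eqI:
  assumes "e = f + int d * t"
  shows "z powi e = z powi f"
  using assms power_d by (simp add: power_int_add power_int_mult)

lemma ev_qint_eqI:
  assumes "e = f + int d * t"
  shows "ev z (qint e) = ev z (qint f)"
  using powi_eqI[OF assms] z_neq_1 by (simp add: ev_qint)

lemma ev_qint_minus: "ev z (qint (- N)) = - (z powi (- N)) * ev z (qint N)"
  using z_neq_1 by (simp add: ev_qint power_int_minus field_simps)

lemma ev_qint_neq_0: "0 < i \<Longrightarrow> i < d \<Longrightarrow> ev z (qint (int i)) \<noteq> 0"
  using power_neq_1[of i] z_neq_1 by (simp add: ev_qint)

text \<open>The numerator contains \<open>[d]\<close>, which vanishes at \<open>z\<close>, while the
  factors of \<open>[e]!\<close> do not since \<open>e < d\<close>.\<close>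

lemma ev_qbinom_d:
  assumes "0 < e" and "e < d"
  shows "ev z (qbinom d (int e)) = 0"
proof -
  have "ev z (qbinom d (int e)) * (\<Prod>i=1..e. ev z (qint (int i)))
      = (\<Prod>i=1..e. ev z (qint (int d - int i + 1)))"
    using arg_cong[OF qbinom_mult_nat[of d e], of "ev z"] by simp
  also have "\<dots> = 0"
    using assms power_d z_neq_1 by (intro prod_zero) (auto intro!: bexI[of _ 1] simp: ev_qint)
  finally show ?thesis
    using assms by (auto simp: ev_qint_neq_0)
qed

lemma ev_qbinom_Suc_Suc:
  "ev z (qbinom (Suc N) (int (Suc k)))
     = ev z (qbinom N (int k)) + z ^ Suc k * ev z (qbinom N (int (Suc k)))"
proof -
  have "z powi int (Suc k) = z ^ Suc k" by (rule power_int_of_nat)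
  then show ?thesis by (simp only: qbinom_Suc_Suc ev_add ev_mult[OF z_neq_0] ev_qpow)
qed

lemma power_mult_d_add: "z ^ (c * d + e) = z ^ e"
  by (simp add: power_add power_mult mult.commute[of c] power_d)

text \<open>In the proof, \<open>carry\<close> is the passage from \<open>b = d - 1\<close> to \<open>b = 0\<close>.\<close>

lemma ev_qbinom_lucas:
  assumes "b < d" and "e < d"
  shows "ev z (qbinom (a * d + b) (int (c * d + e)))
    = of_nat (a choose c) * ev z (qbinom b (int e))"
proof -
  let ?X = "\<lambda>N k. ev z (qbinom N (int k))"
  \<comment> \<open>The upper index grows by one at a time through the Pascal rule; its two
    neighbours in the lower index require \<open>c\<close> and \<open>e\<close> to be
    quantified.\<close>
  let ?P = "\<lambda>a b. \<forall>c e. e < d \<longrightarrow> ?X (a * d + b) (c * d + e) = of_nat (a choose c) * ?X b e"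
  have step: "?P a (Suc b)" if IH: "?P a b" and "Suc b < d" for a b
  proof (intro allI impI)
    fix c e assume "e < d"
    show "?X (a * d + Suc b) (c * d + e) = of_nat (a choose c) * ?X (Suc b) e"
    proof (cases e)
      case (Suc e')
      have "?X (Suc (a * d + b)) (Suc (c * d + e'))
          = ?X (a * d + b) (c * d + e') + z ^ e * ?X (a * d + b) (c * d + e)"
        using power_mult_d_add[of c e] by (simp only: ev_qbinom_Suc_Suc Suc add_Suc_right)
      also have "\<dots> = of_nat (a choose c) * (?X b e' + z ^ e * ?X b e)"
        using IH \<open>e < d\<close> Suc by (simp only: Suc_lessD) (simp only: algebra_simps)
      also have "\<dots> = of_nat (a choose c) * ?X (Suc b) e"
        by (simp only: Suc ev_qbinom_Suc_Suc)
      finally show ?thesis by (simp only: Suc add_Suc_right)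
    next
      case 0
      show ?thesis
      proof (cases c)
        case (Suc c')
        \<comment> \<open>The predecessor of \<open>c * d\<close> has last digit
          \<open>d - 1\<close> in base \<open>d\<close>; its Pascal term vanishes because
          \<open>b < d - 1\<close>.\<close>
        define k where "k = c' * d + (d - 1)"
        have k: "Suc k = c * d + 0"
          using \<open>Suc b < d\<close> by (simp add: k_def Suc)
        have "?X (a * d + b) k = of_nat (a choose c') * ?X b (d - 1)"
          unfolding k_def by (intro IH[rule_format]) (use d_ge_2 in simp)
        also have "qbinom b (int (d - 1)) = 0"
          by (rule qbinom_nat_gt) (use \<open>Suc b < d\<close> in simp)
        finally have "?X (Suc (a * d + b)) (Suc k) = z ^ Suc k * ?X (a * d + b) (Suc k)"
          by (simp only: ev_qbinom_Suc_Suc ev_0 mult_zero_right add_0)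
        also have "\<dots> = ?X (a * d + b) (c * d + 0)"
          unfolding k power_mult_d_add by simp
        also have "\<dots> = of_nat (a choose c)"
          using IH[rule_format, of 0 c] d_ge_2 by simp
        finally show ?thesis unfolding k 0 by simp
      qed (simp add: 0)
    qed
  qed
  have carry: "?P (Suc a) 0" if IH: "?P a (d - 1)" for a
  proof (intro allI impI)
    fix c e assume "e < d"
    have N: "Suc a * d + 0 = Suc (a * d + (d - 1))"
      using d_ge_2 by simp
    show "?X (Suc a * d + 0) (c * d + e) = of_nat (Suc a choose c) * ?X 0 e"
    proof (cases e)
      case (Suc e')
      have "?X (Suc (a * d + (d - 1))) (Suc (c * d + e'))
          = ?X (a * d + (d - 1)) (c * d + e') + z ^ e * ?X (a * d + (d - 1)) (c * d + e)"
        using power_mult_d_add[of c e] by (simp only: ev_qbinom_Suc_Suc Suc add_Suc_right)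
      also have "\<dots> = of_nat (a choose c) * (?X (d - 1) e' + z ^ e * ?X (d - 1) e)"
        using IH \<open>e < d\<close> Suc by (simp only: Suc_lessD) (simp only: algebra_simps)
      \<comment> \<open>Pascal's rule read backwards produces the upper index \<open>d\<close>,
        where the \<open>q\<close>-binomial vanishes at \<open>z\<close>.\<close>
      also have "?X (d - 1) e' + z ^ e * ?X (d - 1) e = ?X (Suc (d - 1)) e"
        by (simp only: Suc ev_qbinom_Suc_Suc)
      also have "\<dots> = 0"
        using ev_qbinom_d[of e] \<open>e < d\<close> Suc by simp
      finally have "?X (Suc a * d + 0) (c * d + e) = 0"
        by (simp only: N Suc add_Suc_right mult_zero_right)
      moreover have "qbinom 0 (int e) = 0"
        by (rule qbinom_nat_gt) (simp add: Suc)
      ultimately show ?thesis by simp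
    next
      case 0
      show ?thesis
      proof (cases c)
        case (Suc c')
        \<comment> \<open>Now the upper index also ends in \<open>d - 1\<close>, so this term
          contributes \<open>a choose c'\<close> and the ordinary Pascal rule for
          \<open>Suc a choose c\<close> emerges.\<close>
        define k where "k = c' * d + (d - 1)"
        have k: "Suc k = c * d + 0"
          using d_ge_2 by (simp add: k_def Suc)
        have "?X (a * d + (d - 1)) k = of_nat (a choose c')"
          unfolding k_def using IH[rule_format, of "d - 1" c'] d_ge_2
          by (simp add: qbinom_self del: of_nat_add of_nat_mult of_nat_diff)
        then have "?X (Suc (a * d + (d - 1))) (Suc k)
            = of_nat (a choose c') + z ^ Suc k * ?X (a * d + (d - 1)) (Suc k)"
          by (simp only: ev_qbinom_Suc_Suc)
        also have "z ^ Suc k * ?X (a * d + (d - 1)) (Suc k) = ?X (a * d + (d - 1)) (c * d + 0)"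
          unfolding k power_mult_d_add by simp
        also have "\<dots> = of_nat (a choose c)"
          using IH[rule_format, of 0 c] d_ge_2 by simp
        finally show ?thesis unfolding k N[symmetric] 0 by (simp add: Suc)
      qed (simp add: 0)
    qed
  qed
  have base: "?P 0 0"
  proof (intro allI impI)
    fix c e :: nat
    assume "e < d"
    show "?X (0 * d + 0) (c * d + e) = of_nat (0 choose c) * ?X 0 e"
      by (cases c) (use d_ge_2 in \<open>auto simp: qbinom_nat_gt simp del: of_nat_add of_nat_mult\<close>)
  qed
  have block: "?P a b" if "?P a 0" "b < d" for a b
    using that(2) by (induction b) (use that(1) step[of a] in auto)
  have "?P a 0" for a
  proof (induction a)
    case 0
    show ?case by (rule base)
  next
    case (Suc a)
    from d_ge_2 have "d - 1 < d" by simp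
    then show ?case by (rule carry[OF block[OF Suc]])
  qed
  with block assms show ?thesis by blast
qed

section \<open>The coefficients \<open>narayana\<close> at a root of unity\<close>

text \<open>A carry in \<open>b + e\<close> gives \<open>k + j\<close> the last digit
  \<open>b + e - d\<close>, which is at most \<open>e - 2\<close>. By \<open>q\<close>-Lucas both
  binomials with upper index \<open>k + j\<close> vanish.\<close>

lemma ev_narayana_mult_d_add_eq_0:
  assumes "b + 2 \<le> d" and "0 < b" and "e < d" and "0 < e" and "d \<le> b + e"
  shows "ev z (narayana (a * d + b) (c * d + e)) = 0"
proof -
  let ?X = "\<lambda>N k. ev z (qbinom N (int k))"
  define f where "f = b + e - d"
  have f: "a * d + b + (c * d + e) = (a + c + 1) * d + f" "f < d" "f < e - 1"
    using assms by (simp_all add: f_def algebra_simps)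
  have "qbinom f (int e) = 0" "qbinom f (int (e - 1)) = 0"
    using f by (intro qbinom_nat_gt; simp)+
  moreover have "?X ((a + c + 1) * d + f) (c * d + e) = of_nat ((a + c + 1) choose c) * ?X f e"
    "?X ((a + c + 1) * d + f) (c * d + (e - 1)) = of_nat ((a + c + 1) choose c) * ?X f (e - 1)"
    using f assms by (intro ev_qbinom_lucas; simp)+
  moreover have "int (c * d + e) - 1 = int (c * d + (e - 1))"
    using assms by linarith
  ultimately show ?thesis
    unfolding narayana_def f
    by (simp only: ev_diff ev_mult[OF z_neq_0] ev_0 mult_zero_right diff_0_right)
qed

text \<open>Each of the two products has a factor with lower index \<open>c * d - 1\<close>. Its
  last digit \<open>d - 1\<close> exceeds the last digit of the upper index, \<open>b - 1\<close> or
  \<open>b\<close>.\<close>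

lemma ev_narayana_mult_d:
  assumes "b + 2 \<le> d" and "0 < b" and "0 < c"
  shows "ev z (narayana (a * d + b) (c * d)) = 0"
proof -
  let ?X = "\<lambda>N k. ev z (qbinom N (int k))"
  obtain c' where c: "c = Suc c'" using assms by (cases c) auto
  define k where "k = c' * d + (d - 1)"
  have k: "int (c * d) - 1 = int k"
    using d_ge_2 by (simp add: k_def c of_nat_diff)
  have "?X (a * d + (b - 1)) k = 0" "?X ((a + c) * d + b) k = 0"
    unfolding k_def using assms
    by (subst ev_qbinom_lucas; simp add: qbinom_nat_gt del: of_nat_add of_nat_mult of_nat_diff)+
  moreover have k': "a * d + b - 1 = a * d + (b - 1)" "a * d + b + c * d = (a + c) * d + b"
    using assms by (simp_all add: algebra_simps)
  ultimately show ?thesis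
    unfolding narayana_def k k' by (simp del: of_nat_add of_nat_mult)
qed

text \<open>Without a carry, \<open>q-Lucas\<close> extracts the same integer factor from both
  products; positivity of \<open>b\<close> and \<open>e\<close> avoids borrowing in
  \<open>b - 1\<close> and \<open>e - 1\<close>. With a carry both sides vanish.\<close>

lemma ev_narayana_lucas:
  assumes "b + 2 \<le> d" and "0 < b" and "e < d" and "0 < e"
  shows "ev z (narayana (a * d + b) (c * d + e))
    = of_nat ((a choose c) * ((a + c) choose c)) * ev z (narayana b e)"
proof (cases "b + e < d")
  case True
  let ?X = "\<lambda>N k. ev z (qbinom N (int k))"
  have j: "int (c * d + e) - 1 = int (c * d + (e - 1))" "int e - 1 = int (e - 1)"
    using assms by linarith+
  have k: "a * d + b - 1 = a * d + (b - 1)" "a * d + b + (c * d + e) = (a + c) * d + (b + e)"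
    using assms by (simp_all add: algebra_simps)
  have "?X (a * d + (b - 1)) (c * d + (e - 1)) = of_nat (a choose c) * ?X (b - 1) (e - 1)"
    "?X (a * d + b) (c * d + e) = of_nat (a choose c) * ?X b e"
    "?X ((a + c) * d + (b + e)) (c * d + e) = of_nat ((a + c) choose c) * ?X (b + e) e"
    "?X ((a + c) * d + (b + e)) (c * d + (e - 1)) = of_nat ((a + c) choose c) * ?X (b + e) (e - 1)"
    using assms True by (intro ev_qbinom_lucas; simp)+
  then show ?thesis
    unfolding narayana_def j k ev_diff ev_mult[OF z_neq_0] by (simp only: of_nat_mult right_diff_distrib mult_ac)
next
  case False
  then show ?thesis
    using assms ev_narayana_mult_d_add_eq_0[of b e a c] ev_narayana_mult_d_add_eq_0[of b e 0 0]
    by simp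
qed

text \<open>The closed form may be divided by its denominator since \<open>e < d\<close>. Modulo
  \<open>d\<close> the reflected index is \<open>-1 - b\<close>, which exchanges the two
  \<open>q\<close>-integers in each factor up to sign and a power of \<open>z\<close>.\<close>

lemma ev_narayana_reflect_small:
  assumes "b + 2 \<le> d" and "0 < b" and "e < d" and "0 < e"
  shows "ev z (narayana (d - 1 - b) e)
    = z powi (- (2 * int b + 1) * int e) * ev z (narayana b e)"
proof -
  let ?g = "\<lambda>N. ev z (qint N)"
  let ?D = "(\<Prod>i=1..e. ?g (int i)) * (\<Prod>i=1..e-1. ?g (int i))"
  define b' where "b' = d - 1 - b"
  have b': "int b' = int d - 1 - int b" "0 < b'"
    using assms by (auto simp: b'_def)
  have D: "?D \<noteq> 0"
    using assms ev_qint_neq_0 by (auto simp del: of_nat_diff)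
  have closed: "ev z (narayana k e) * ?D
      = z powi int k * (\<Prod>i=2..e. ?g (int k + int i) * ?g (int k + 1 - int i))" if "k > 0" for k
    using arg_cong[OF narayana_closed_form[OF that assms(4)], of "ev z"]
    by (simp only: ev_mult[OF z_neq_0] ev_prod[OF z_neq_0] ev_qpow)
  \<comment> \<open>The two signs from \<open>[-N] = -q^(-N) [N]\<close> cancel, and the exponents
    add up to \<open>-(2b + 1)\<close> whatever \<open>i\<close> is.\<close>
  have factor: "?g (int b' + int i) * ?g (int b' + 1 - int i)
      = z powi (- (2 * int b + 1)) * (?g (int b + int i) * ?g (int b + 1 - int i))" for i
  proof -
    have "?g (int b' + int i) = ?g (- (int b + 1 - int i))"
      by (rule ev_qint_eqI[of _ _ 1]) (simp add: b')
    moreover have "?g (int b' + 1 - int i) = ?g (- (int b + int i))"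
      by (rule ev_qint_eqI[of _ _ 1]) (simp add: b')
    moreover have "z powi (- (2 * int b + 1)) = z powi (- (int b + 1 - int i)) * z powi (- (int b + int i))"
      by (simp flip: power_int_add)
    ultimately show ?thesis
      by (simp only: ev_qint_minus) (simp only: mult_minus_left mult_minus_right minus_minus mult_ac)
  qed
  have "ev z (narayana b' e) * ?D = z powi int b' * (z powi (- (2 * int b + 1))) ^ (e - 1)
      * (\<Prod>i=2..e. ?g (int b + int i) * ?g (int b + 1 - int i))"
    unfolding closed[OF b'(2)] factor prod.distrib[of "\<lambda>_. z powi (- (2 * int b + 1))"]
    using assms by (simp add: numeral_2_eq_2)
  \<comment> \<open>The product has only \<open>e - 1\<close> factors; the missing one comes from
    the prefactor, as \<open>b'\<close> is congruent to \<open>b - (2b + 1)\<close> modulo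
    \<open>d\<close>.\<close>
  also have "z powi int b' * (z powi (- (2 * int b + 1))) ^ (e - 1)
      = z powi (- (2 * int b + 1) * int e) * z powi int b"
  proof -
    have "(z powi (- (2 * int b + 1))) ^ (e - 1) = z powi (- (2 * int b + 1) * (int e - 1))"
      using assms by (simp only: power_int_mult flip: power_int_of_nat) (simp add: of_nat_diff)
    then show ?thesis
      by (simp only: flip: power_int_add[OF disjI1[OF z_neq_0]])
        (rule powi_eqI[of _ _ 1], simp add: b' algebra_simps)
  qed
  finally have "ev z (narayana b' e) * ?D
      = z powi (- (2 * int b + 1) * int e) * ev z (narayana b e) * ?D"
    using closed[OF assms(2)] by (simp only: mult.assoc)
  then show ?thesis
    unfolding b'_def by (rule mult_right_cancel[OF D, THEN iffD1])
qed

text \<open>The reflection keeps the quotient \<open>a\<close>, hence also the integer factor from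
  \<open>q\<close>-Lucas; when \<open>d\<close> divides \<open>j\<close>, both sides vanish.\<close>

lemma ev_narayana_reflect:
  assumes "b + 2 \<le> d" and "0 < b" and "0 < j"
  shows "ev z (narayana (a * d + (d - 1 - b)) j)
    = z powi (- (2 * int (a * d + b) + 1) * int j) * ev z (narayana (a * d + b) j)"
proof -
  define c e where "c = j div d" and "e = j mod d"
  have j: "j = c * d + e" "e < d"
    using d_ge_2 by (simp_all add: c_def e_def)
  show ?thesis
  proof (cases "e = 0")
    case True
    then have "0 < c" using j assms by (cases c) auto
    then have "ev z (narayana (a * d + (d - 1 - b)) (c * d)) = 0"
      "ev z (narayana (a * d + b) (c * d)) = 0"
      using assms by (intro ev_narayana_mult_d; simp)+
    with True show ?thesis
      unfolding j by (simp only: add_0_right mult_zero_right)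
  next
    case False
    have "z powi (- (2 * int (a * d + b) + 1) * int j) = z powi (- (2 * int b + 1) * int e)"
      by (rule powi_eqI[of _ _ "- (2 * int b + 1) * int c - 2 * int a * int j"])
        (simp add: j algebra_simps)
    moreover have "ev z (narayana (a * d + (d - 1 - b)) j)
        = of_nat ((a choose c) * ((a + c) choose c)) * ev z (narayana (d - 1 - b) e)"
      "ev z (narayana (a * d + b) j) = of_nat ((a choose c) * ((a + c) choose c)) * ev z (narayana b e)"
      unfolding j(1) using assms False j(2) by (intro ev_narayana_lucas; simp)+
    moreover have "ev z (narayana (d - 1 - b) e)
        = z powi (- (2 * int b + 1) * int e) * ev z (narayana b e)"
      using assms False j(2) by (intro ev_narayana_reflect_small) simp_all
    ultimately show ?thesis by (simp only: mult.left_commute)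
  qed
qed

end

section \<open>The polynomials \<open>w\<close> at a root of unity\<close>

text \<open>One formula serves all \<open>i\<close>: beyond the summation range
  \<open>narayana\<close> is \<open>0\<close>, and so is its power as \<open>\<alpha> > 0\<close>.
  For \<open>k = 0\<close> it would fail, since truncated subtraction makes
  \<open>narayana 0 1\<close> equal to \<open>1\<close>.\<close>

lemma coeff_w:
  assumes "\<alpha> > 0" and "k > 0"
  shows "coeff (w \<alpha> k) i
    = qpow (int \<alpha> * (int ((i + 2) choose 2) - (int k + 1) * int i)) * narayana k (Suc i) ^ \<alpha>"
proof -
  have "coeff (w \<alpha> k) i = (\<Sum>j=1..k. if j = Suc i then
      qpow (int \<alpha> * (int ((j + 1) choose 2) - (int k + 1) * (int j - 1))) * narayana k j ^ \<alpha> else 0)"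
    unfolding w_def narayana_def coeff_sum by (intro sum.cong) auto
  also have "\<dots> = (if i < k then
      qpow (int \<alpha> * (int ((i + 2) choose 2) - (int k + 1) * int i)) * narayana k (Suc i) ^ \<alpha> else 0)"
    by (subst sum.delta) auto
  also have "narayana k (Suc i) = 0" if "\<not> i < k"
  proof -
    have "qbinom (k - 1) (int (Suc i) - 1) = 0" "qbinom k (int (Suc i)) = 0"
      using that assms by (auto intro!: qbinom_gt)
    then show ?thesis by (simp only: narayana_def mult_zero_left diff_0_right)
  qed
  ultimately show ?thesis
    using assms by (cases "i < k") (auto simp: power_0_left)
qed

definition evp :: "complex \<Rightarrow> laurent poly \<Rightarrow> complex poly" where
  "evp z = map_poly (ev z)"

lemma coeff_evp [simp]: "coeff (evp z p) i = ev z (coeff p i)"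
  by (simp add: evp_def coeff_map_poly)

lemma evp_1 [simp]: "evp z 1 = 1"
  by (simp add: evp_def)

lemma evp_mult: "z \<noteq> 0 \<Longrightarrow> evp z (p * q) = evp z p * evp z q"
  by (intro poly_eqI) (simp add: coeff_mult)

lemma evp_power: "z \<noteq> 0 \<Longrightarrow> evp z (p ^ i) = evp z p ^ i"
  by (induction i) (simp_all add: evp_mult)

lemma evp_smult: "z \<noteq> 0 \<Longrightarrow> evp z (smult c p) = smult (ev z c) (evp z p)"
  by (intro poly_eqI) simp

lemma evp_sum: "evp z (sum f A) = (\<Sum>i\<in>A. evp z (f i))"
  by (intro poly_eqI) (simp add: coeff_sum)

context primitive_root
begin

text \<open>The reflection factor of a coefficient depends on \<open>i\<close>, but so does the
  power of \<open>q\<close> in \<open>w\<close>. As \<open>k' + 1\<close> is congruent to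
  \<open>-k\<close> modulo \<open>d\<close>, the identity
  \<open>k i - (2k+1)(i+1) = -(k+1) i - (2k+1)\<close> leaves a factor independent of
  \<open>i\<close>.\<close>

lemma evp_w_reflect:
  assumes "\<alpha> > 0" and "b + 2 \<le> d" and "0 < b"
  shows "evp z (w \<alpha> (a * d + (d - 1 - b)))
    = smult (z powi (- int \<alpha> * (2 * int (a * d + b) + 1))) (evp z (w \<alpha> (a * d + b)))"
proof (rule poly_eqI)
  fix i
  define k k' where "k = a * d + b" and "k' = a * d + (d - 1 - b)"
  have pos: "k > 0" "k' > 0" and k': "int k' = (2 * int a + 1) * int d - 1 - int k"
    using assms by (auto simp: k_def k'_def of_nat_diff algebra_simps)
  define c where "c = int ((i + 2) choose 2)"
  define u where "u = ev z (narayana k (Suc i))"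
  have "ev z (narayana k' (Suc i)) = z powi (- (2 * int k + 1) * int (Suc i)) * u"
    using assms unfolding k_def k'_def u_def by (intro ev_narayana_reflect) auto
  then have "coeff (evp z (w \<alpha> k')) i
      = z powi (int \<alpha> * (c - (int k' + 1) * int i)) * z powi (int \<alpha> * (- (2 * int k + 1) * int (Suc i))) * u ^ \<alpha>"
    using coeff_w[OF assms(1) pos(2)]
    by (simp add: c_def power_mult_distrib mult.commute[of "int \<alpha>"] power_int_mult del: of_nat_Suc)
  also have "z powi (int \<alpha> * (c - (int k' + 1) * int i)) * z powi (int \<alpha> * (- (2 * int k + 1) * int (Suc i)))
      = z powi (int \<alpha> * (c - (int k' + 1) * int i) + int \<alpha> * (- (2 * int k + 1) * int (Suc i)))"
    by (simp add: power_int_add)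
  also have "\<dots> = z powi (- int \<alpha> * (2 * int k + 1) + int \<alpha> * (c - (int k + 1) * int i))"
    by (rule powi_eqI[of _ _ "- int \<alpha> * (2 * int a + 1) * int i"]) (simp add: k' algebra_simps)
  also have "\<dots> = z powi (- int \<alpha> * (2 * int k + 1)) * z powi (int \<alpha> * (c - (int k + 1) * int i))"
    by (rule power_int_add[OF disjI1[OF z_neq_0]])
  finally show "coeff (evp z (w \<alpha> k')) i
      = coeff (smult (z powi (- int \<alpha> * (2 * int k + 1))) (evp z (w \<alpha> k))) i"
    using coeff_w[OF assms(1) pos(1)] by (simp add: c_def u_def mult.assoc)
qed

section \<open>Vanishing and cancellation of the summands\<close>

text \<open>Modulo \<open>d\<close>, \<open>k' + 1\<close> is \<open>-(k + 1)\<close>. This fixes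
  \<open>k(k+2) = (k+1)^2 - 1\<close>, negates \<open>2(k+1)\<close>, which yields the sign, and
  exchanges the two \<open>w\<close> factors up to powers of \<open>z\<close>. Reflecting
  \<open>Suc b\<close> as well as \<open>b\<close> is what requires
  \<open>b + 3 \<le> d\<close>.\<close>

lemma summand_reflect:
  fixes \<alpha> m n r :: nat
  defines "T \<equiv> \<lambda>k. smult (qint (int k * (int k + 2)) ^ r * qint (2 * (int k + 1))
             * qpow ((int n - 2 - int k) * (2 * int \<alpha> * int m + 1)))
        ((w \<alpha> k * w \<alpha> (k + 1)) ^ m)"
  assumes "\<alpha> > 0" and "b + 3 \<le> d" and "0 < b"
  shows "evp z (T (a * d + (d - 2 - b))) = - evp z (T (a * d + b))"
proof -
  define k k' where "k = a * d + b" and "k' = a * d + (d - 2 - b)"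
  define M where "M = (2 * int a + 1) * int d"
  define s where "s = 2 * int \<alpha> * int m + 1"
  have k': "int k' = M - 2 - int k"
    using assms by (auto simp: k_def k'_def M_def of_nat_diff algebra_simps)
  have "a * d + (d - 1 - Suc b) = k'" "a * d + Suc b = k + 1"
    "a * d + (d - 1 - b) = k' + 1"
    using assms by (auto simp: k_def k'_def)
  then have w: "evp z (w \<alpha> k') = smult (z powi (- int \<alpha> * (2 * int (k + 1) + 1))) (evp z (w \<alpha> (k + 1)))"
    "evp z (w \<alpha> (k' + 1)) = smult (z powi (- int \<alpha> * (2 * int k + 1))) (evp z (w \<alpha> k))"
    using assms evp_w_reflect[of \<alpha> "Suc b" a] evp_w_reflect[of \<alpha> b a] by (simp_all add: k_def)
  define W where "W = evp z (w \<alpha> k) * evp z (w \<alpha> (k + 1))"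
  have "evp z (w \<alpha> k') * evp z (w \<alpha> (k' + 1))
      = smult (z powi (- int \<alpha> * (2 * int (k + 1) + 1)) * z powi (- int \<alpha> * (2 * int k + 1))) W"
    unfolding w W_def by (simp add: mult.commute)
  also have "z powi (- int \<alpha> * (2 * int (k + 1) + 1)) * z powi (- int \<alpha> * (2 * int k + 1))
      = z powi (- 4 * int \<alpha> * (int k + 1))"
    by (simp add: algebra_simps flip: power_int_add)
  finally have WW: "evp z (w \<alpha> k') * evp z (w \<alpha> (k' + 1)) = smult (z powi (- 4 * int \<alpha> * (int k + 1))) W" .
  have "(z powi (- 4 * int \<alpha> * (int k + 1))) ^ m = z powi (- 4 * int \<alpha> * (int k + 1) * int m)"
    by (simp only: power_int_mult[of z _ "int m"] power_int_of_nat)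
  then have W': "(evp z (w \<alpha> k') * evp z (w \<alpha> (k' + 1))) ^ m
      = smult (z powi (- 4 * int \<alpha> * (int k + 1) * int m)) (W ^ m)"
    by (simp only: WW smult_power)
  have g1: "ev z (qint (int k' * (int k' + 2))) = ev z (qint (int k * (int k + 2)))"
    by (rule ev_qint_eqI[of _ _ "(2 * int a + 1) * (M - 2 * (int k + 1))"])
      (simp add: k', simp add: M_def algebra_simps)
  have "ev z (qint (2 * (int k' + 1))) = ev z (qint (- (2 * (int k + 1))))"
    by (rule ev_qint_eqI[of _ _ "2 * (2 * int a + 1)"])
      (simp add: k', simp add: M_def algebra_simps)
  then have g2: "ev z (qint (2 * (int k' + 1)))
      = - (z powi (- (2 * (int k + 1)))) * ev z (qint (2 * (int k + 1)))"
    by (simp only: ev_qint_minus)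
  have "z powi ((int n - 2 - int k') * s)
      = z powi ((int n - 2 - int k) * s + 2 * (int k + 1) * s)"
    by (rule powi_eqI[of _ _ "- (2 * int a + 1) * s"])
      (simp add: k', simp add: M_def algebra_simps)
  also have "\<dots> = z powi ((int n - 2 - int k) * s) * z powi (2 * (int k + 1) * s)"
    by (simp add: power_int_add)
  finally have g3: "z powi ((int n - 2 - int k') * s)
      = z powi ((int n - 2 - int k) * s) * z powi (2 * (int k + 1) * s)" .
  \<comment> \<open>The multiplier \<open>s = 2 \<alpha> m + 1\<close> is exactly what makes the
    exponents sum to zero.\<close>
  have cancel: "z powi (- (2 * (int k + 1))) * z powi (2 * (int k + 1) * s)
      * z powi (- 4 * int \<alpha> * (int k + 1) * int m) = 1"
    by (simp add: s_def algebra_simps flip: power_int_add)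
  have T: "evp z (T l) = smult (ev z (qint (int l * (int l + 2))) ^ r * ev z (qint (2 * (int l + 1)))
      * z powi ((int n - 2 - int l) * s)) ((evp z (w \<alpha> l) * evp z (w \<alpha> (l + 1))) ^ m)" for l
    by (simp only: T_def s_def evp_smult[OF z_neq_0] evp_power[OF z_neq_0] evp_mult[OF z_neq_0]
        ev_mult[OF z_neq_0] ev_power[OF z_neq_0] ev_qpow)
  let ?G = "ev z (qint (int k * (int k + 2))) ^ r"
  let ?H = "ev z (qint (2 * (int k + 1)))"
  let ?Z = "z powi ((int n - 2 - int k) * s)"
  have "evp z (T k') = smult (?G * (- (z powi (- (2 * (int k + 1)))) * ?H)
      * (?Z * z powi (2 * (int k + 1) * s)) * z powi (- 4 * int \<alpha> * (int k + 1) * int m)) (W ^ m)"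
    unfolding T W' g1 g2 g3 smult_smult ..
  also have "?G * (- (z powi (- (2 * (int k + 1)))) * ?H)
      * (?Z * z powi (2 * (int k + 1) * s)) * z powi (- 4 * int \<alpha> * (int k + 1) * int m)
      = - (?G * ?H * ?Z) * (z powi (- (2 * (int k + 1))) * z powi (2 * (int k + 1) * s)
      * z powi (- 4 * int \<alpha> * (int k + 1) * int m))"
    by (simp only: mult_minus_left mult_minus_right mult_ac)
  also have "\<dots> = - (?G * ?H * ?Z)"
    unfolding cancel by (rule mult_1_right)
  also have "smult \<dots> (W ^ m) = - evp z (T k)"
    unfolding T W_def by (rule smult_minus_left)
  finally show ?thesis unfolding k_def k'_def .
qed

text \<open>For the remainders \<open>0\<close> and \<open>d - 2\<close> the vanishing factor is
  \<open>[k(k+2)]\<close>, whose power is zero because \<open>r > 0\<close>; for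
  \<open>d - 1\<close> it is \<open>[2(k+1)]\<close>.\<close>

lemma summand_eq_0:
  fixes \<alpha> m n r :: nat
  defines "T \<equiv> \<lambda>k. smult (qint (int k * (int k + 2)) ^ r * qint (2 * (int k + 1))
             * qpow ((int n - 2 - int k) * (2 * int \<alpha> * int m + 1)))
        ((w \<alpha> k * w \<alpha> (k + 1)) ^ m)"
  assumes "r > 0" and "\<not> (0 < k mod d \<and> k mod d + 3 \<le> d)"
  shows "evp z (T k) = 0"
proof -
  define a b where "a = k div d" and "b = k mod d"
  have k: "k = a * d + b" and b: "b < d"
    using d_ge_2 by (simp_all add: a_def b_def)
  have zero: "ev z (qint e) = 0" if "e = int d * t" for e t
    using ev_qint_eqI[of e 0 t] that by simp
  consider "b = 0" | "b + 2 = d" | "b + 1 = d"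
    using assms(3) b by (force simp: b_def)
  then have "ev z (qint (int k * (int k + 2))) = 0 \<or> ev z (qint (2 * (int k + 1))) = 0"
  proof cases
    case 1
    then have "int k * (int k + 2) = int d * (int a * (int k + 2))" by (simp add: k)
    then show ?thesis using zero by blast
  next
    case 2
    then have "int k + 2 = int d * (int a + 1)" by (simp add: k flip: 2) (simp add: algebra_simps)
    then have "int k * (int k + 2) = int d * (int k * (int a + 1))" by simp
    then show ?thesis using zero by blast
  next
    case 3
    then have "2 * (int k + 1) = int d * (2 * (int a + 1))" by (simp add: k flip: 3) (simp add: algebra_simps)
    then show ?thesis using zero by blast
  qed
  then have "ev z (qint (int k * (int k + 2)) ^ r * qint (2 * (int k + 1))) = 0"
    using assms(2) by auto
  then show ?thesis
    by (simp only: T_def evp_smult[OF z_neq_0] ev_mult[OF z_neq_0, of "_ * _"] mult_zero_left smult_0_left)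
qed

text \<open>Since \<open>d\<close> divides \<open>n\<close>, reflecting the remainder within each
  block of length \<open>d\<close> permutes the surviving indices. The sum therefore equals its own
  negative, which also covers fixed points of the reflection.\<close>

lemma sum_eq_0_reflect:
  fixes T :: "nat \<Rightarrow> complex poly"
  assumes "d dvd n"
    and zero: "\<And>k. \<not> (0 < k mod d \<and> k mod d + 3 \<le> d) \<Longrightarrow> T k = 0"
    and reflect: "\<And>a b. 0 < b \<Longrightarrow> b + 3 \<le> d \<Longrightarrow> T (a * d + (d - 2 - b)) = - T (a * d + b)"
  shows "(\<Sum>k<n. T k) = 0"
proof -
  obtain N where n: "n = d * N" using assms(1) by blast
  let ?A = "{k \<in> {..<n}. 0 < k mod d \<and> k mod d + 3 \<le> d}"
  define \<sigma> where "\<sigma> k = k div d * d + (d - 2 - k mod d)" for k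
  have \<sigma>: "\<sigma> k mod d = d - 2 - k mod d" "\<sigma> k div d = k div d" for k
    using d_ge_2 by (simp_all add: \<sigma>_def less_imp_diff_less)
  have \<sigma>_in: "\<sigma> k \<in> ?A" if "k \<in> ?A" for k
  proof -
    have "k div d < N"
      using that n by (simp add: less_mult_imp_div_less mult.commute)
    then have "\<sigma> k div d < N" by (simp only: \<sigma>)
    then have "\<sigma> k < n"
      using d_ge_2 n by (simp only: div_less_iff_less_mult mult.commute)
    with that show ?thesis unfolding mem_Collect_eq \<sigma> by auto
  qed
  have \<sigma>_\<sigma>: "\<sigma> (\<sigma> k) = k" if "k \<in> ?A" for k
  proof -
    have "d - 2 - (d - 2 - k mod d) = k mod d" using that by auto
    then show ?thesis by (simp only: \<sigma>_def[of "\<sigma> k"] \<sigma> div_mult_mod_eq)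
  qed
  have restrict: "(\<Sum>k<n. T k) = sum T ?A"
    by (intro sum.mono_neutral_right) (use zero in auto)
  also have "\<dots> = (\<Sum>k\<in>?A. T (\<sigma> k))"
    by (rule sum.reindex_bij_witness[of _ \<sigma> \<sigma>]) (simp_all only: \<sigma>_in \<sigma>_\<sigma>)
  also have "\<dots> = - sum T ?A"
    unfolding sum_negf[symmetric]
  proof (rule sum.cong)
    fix k assume "k \<in> ?A"
    then show "T (\<sigma> k) = - T k"
      using reflect[of "k mod d" "k div d"] by (simp only: \<sigma>_def div_mult_mod_eq mem_Collect_eq)
  qed simp
  finally have "(\<Sum>k<n. T k) = - (\<Sum>k<n. T k)"
    unfolding restrict .
  then have "coeff (\<Sum>k<n. T k) i = - coeff (\<Sum>k<n. T k) i" for i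
    unfolding coeff_minus[symmetric] by (rule arg_cong)
  then have "2 * coeff (\<Sum>k<n. T k) i = 0" for i
    by (simp only: mult_2 eq_neg_iff_add_eq_0)
  then show ?thesis
    by (intro poly_eqI) (simp only: mult_eq_0_iff zero_neq_numeral[symmetric] simp_thms coeff_0)
qed

end

section \<open>The order of a root of unity, and the conclusion\<close>

lemma primitive_root_exists:
  assumes "z ^ n = 1" and "z \<noteq> 1" and "n > 0"
  obtains d where "primitive_root z d" and "d dvd n"
proof -
  define d where "d = (LEAST d. 0 < d \<and> z ^ d = 1)"
  have d: "0 < d" "z ^ d = 1"
    using LeastI[of "\<lambda>d. 0 < d \<and> z ^ d = 1" n] assms by (auto simp: d_def)
  have least: "z ^ i \<noteq> 1" if "0 < i" "i < d" for i
    using not_less_Least[of i "\<lambda>d. 0 < d \<and> z ^ d = 1"] that by (auto simp: d_def)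
  have "d \<noteq> 1" using d assms by auto
  with d least have "primitive_root z d"
    by unfold_locales auto
  moreover have "z ^ n = z ^ (n mod d)"
  proof -
    have "z ^ n = z ^ (d * (n div d) + n mod d)" by simp
    also have "\<dots> = z ^ (n mod d)" by (simp only: power_add power_mult d power_one mult_1_left)
    finally show ?thesis .
  qed
  then have "d dvd n"
    using least[of "n mod d"] d assms(1) by (auto simp: dvd_eq_mod_eq_0)
  ultimately show ?thesis using that by blast
qed

theorem theorem4:
  fixes \<alpha> m n r :: nat
  assumes "\<alpha> > 0" and "m > 0" and "n > 0" and "r > 0"
  shows "[:qint (int n):] dvd
    (\<Sum>k = 0..n - 1.
      smult (qint (int k * (int k + 2)) ^ r
             * qint (2 * (int k + 1))
             * qpow ((int n - 2 - int k) * (2 * int \<alpha> * int m + 1)))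
        ((w \<alpha> k * w \<alpha> (k + 1)) ^ m))"
  (is "_ dvd sum ?T _")
proof -
  \<comment> \<open>A constant polynomial divides exactly when it divides every coefficient, so each
    coefficient in \<open>x\<close> is tested separately at the roots of unity.\<close>
  have "ev z (coeff (sum ?T {0..n - 1}) i) = 0" if z: "z ^ n = 1" "z \<noteq> 1" for z i
  proof -
    obtain d where "primitive_root z d" and "d dvd n"
      using primitive_root_exists[OF z assms(3)] .
    interpret primitive_root z d by fact
    have "{0..n - 1} = {..<n}" using assms(3) by auto
    then have "evp z (sum ?T {0..n - 1}) = (\<Sum>k<n. evp z (?T k))"
      by (simp only: evp_sum)
    also have "\<dots> = 0"
      using \<open>d dvd n\<close>
    proof (rule sum_eq_0_reflect)
      show "evp z (?T k) = 0" if "\<not> (0 < k mod d \<and> k mod d + 3 \<le> d)" for k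
        using assms(4) that by (rule summand_eq_0)
      show "evp z (?T (a * d + (d - 2 - b))) = - evp z (?T (a * d + b))"
        if "0 < b" "b + 3 \<le> d" for a b
        using assms(1) that(2,1) by (rule summand_reflect)
    qed
    finally have "coeff (evp z (sum ?T {0..n - 1})) i = 0"
      by (simp only: coeff_0)
    then show ?thesis by (simp only: coeff_evp)
  qed
  then show ?thesis
    unfolding const_poly_dvd_iff using qint_dvd_if_roots[OF assms(3)] by blast
qed

end
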